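(* Let $n\ge2$ be an integer and $c$ a real number. For $a,b\in\{1,\dots,n+1\}$ and $i,j\in\{1,\dots,n\}$ let $$s^{ab}_{ij}=\begin{cases} c+\frac1n & \text{if } a\ne b \text{ and } i\neq j,\\ \frac1n-(n-1)c & \text{if } a\neq b\text{ and } i=j,\\ \delta_{ij} & \text{if } a=b.\end{cases}$$ Let $\Gamma'$ be the $(n^2-1)\times(n^2-1)$ matrix formed as an $(n+1)\times(n+1)$ array of blocks of size $(n-1)\times(n-1)$, whose diagonal blocks are all the identity matrix of order $n-1$ and whose off-diagonal block in position $(a,b)$, $a\ne b$, is the matrix $\Psi^{ab}$ with entries $\Psi^{ab}_{ij}=s^{ab}_{ij}-s^{ab}_{nj}$, $i,j=1,\dots,n-1$. Then $$\det\Gamma'=(1+nc)^{n^2-n}\,(1-n^2c)^{n-1}.$$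
   Context: The numbers $s^{ab}_{ij}$ model the transition probabilities $|\langle\alpha_i^a|\alpha_j^b\rangle|^2$ between vectors of $n+1$ orthonormal bases of an $n$-dimensional complex Hilbert space; $\delta_{ij}$ is the Kronecker delta. *)

theory Defs
  imports "Jordan_Normal_Form.Determinant" Complex_Main
begin

text \<open>The superscripts \<open>a, b\<close> range over \<open>1, \<dots>, n + 1\<close> and the subscripts \<open>i, j\<close> over
  \<open>1, \<dots>, n\<close>, whereas rows and columns of matrices are numbered from \<open>0\<close>.\<close>

definition s :: "nat \<Rightarrow> real \<Rightarrow> nat \<Rightarrow> nat \<Rightarrow> nat \<Rightarrow> nat \<Rightarrow> real" where
  "s n c a b i j =
     (if a \<noteq> b then
        (if i \<noteq> j then c + 1 / real n else 1 / real n - (real n - 1) * c)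
      else (if i = j then 1 else 0))"

definition Psi :: "nat \<Rightarrow> real \<Rightarrow> nat \<Rightarrow> nat \<Rightarrow> real mat" where
  "Psi n c a b =
     mat (n - 1) (n - 1)
       (\<lambda>(i, j). s n c a b (i + 1) (j + 1) - s n c a b n (j + 1))"

definition Gamma_block :: "nat \<Rightarrow> real \<Rightarrow> nat \<Rightarrow> nat \<Rightarrow> real mat" where
  "Gamma_block n c a b = (if a = b then 1\<^sub>m (n - 1) else Psi n c a b)"

text \<open>Row \<open>p\<close> lies in block row \<open>p div (n - 1) + 1\<close>, at (0-based) position \<open>p mod (n - 1)\<close>
  inside the block; likewise for columns.\<close>

definition Gamma' :: "nat \<Rightarrow> real \<Rightarrow> real mat" where
  "Gamma' n c =
     mat (n^2 - 1) (n^2 - 1)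
       (\<lambda>(p, q). Gamma_block n c (p div (n - 1) + 1) (q div (n - 1) + 1)
                   $$ (p mod (n - 1), q mod (n - 1)))"

end

theory Submission
  imports Defs
begin

text \<open>For \<open>i, j < n\<close> the entries \<open>s\<^sup>a\<^sup>b\<^sub>i\<^sub>j - s\<^sup>a\<^sup>b\<^sub>n\<^sub>j\<close> with \<open>a \<noteq> b\<close> are \<open>- n c\<close> on the diagonal
  and \<open>0\<close> elsewhere. Hence the matrix is the Kronecker product \<open>M \<otimes> I\<close>, where \<open>M\<close> has order
  \<open>n + 1\<close>, diagonal entries \<open>1\<close> and off-diagonal entries \<open>- n c\<close>. The all-ones vector is an
  eigenvector of \<open>M\<close>; replacing the first unit vector by it brings \<open>M\<close> to upper triangular form,
  with one diagonal entry \<open>1 - n\<^sup>2 c\<close> and \<open>n\<close> diagonal entries \<open>1 + n c\<close>.\<close>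

lemma card_residue_class_lessThan:
  fixes k m q :: nat
  assumes "q < m"
  shows "card {r \<in> {0..<k * m}. r mod m = q} = k"
proof -
  have "{r \<in> {0..<k * m}. r mod m = q} = (\<lambda>i. i * m + q) ` {..<k}"
  proof (intro equalityI subsetI)
    fix r assume "r \<in> {r \<in> {0..<k * m}. r mod m = q}"
    then have r: "r < k * m" "r mod m = q" by auto
    then have "r div m < k" by (simp add: less_mult_imp_div_less)
    moreover have "r = r div m * m + q" using r(2) div_mult_mod_eq[of r m] by simp
    ultimately show "r \<in> (\<lambda>i. i * m + q) ` {..<k}" by blast
  next
    fix r assume "r \<in> (\<lambda>i. i * m + q) ` {..<k}"
    then obtain i where i: "i < k" "r = i * m + q" by blast
    have "i * m + q < Suc i * m" using assms by simp
    also have "\<dots> \<le> k * m" using i(1) by (intro mult_le_mono1) simp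
    finally show "r \<in> {r \<in> {0..<k * m}. r mod m = q}" using i assms by simp
  qed
  moreover have "inj_on (\<lambda>i. i * m + q) {..<k}" using assms by (auto simp: inj_on_def)
  ultimately show ?thesis by (simp add: card_image)
qed

lemma det_two_valued_block_matrix:
  fixes d t :: "'a :: idom" and k m :: nat
  assumes m: "m > 0"
  defines "N \<equiv> (k + 1) * m"
  shows "det (mat N N (\<lambda>(p, q). if p = q then d else if p mod m = q mod m then t else 0))
           = (d + of_nat k * t) ^ m * (d - t) ^ (k * m)"
proof -
  define A where
    "A = mat N N (\<lambda>(p, q). if p = q then d else if p mod m = q mod m then t else 0)"
  \<comment> \<open>For \<open>q < m\<close>, column \<open>q\<close> is the all-ones vector
    tensored with a unit vector; the other columns are unit vectors.\<close>
  define U :: "'a mat" where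
    "U = mat N N (\<lambda>(p, q). if p = q then 1 else if q < m \<and> p mod m = q then 1 else 0)"
  \<comment> \<open>For \<open>q \<ge> m\<close>, \<open>A\<close> sends the unit vector
    \<open>q\<close> to \<open>d - t\<close> times itself plus \<open>t\<close> times column
    \<open>q mod m\<close> of \<open>U\<close>.\<close>
  define T where
    "T = mat N N (\<lambda>(p, q). if p = q then (if p < m then d + of_nat k * t else d - t)
                           else if p < m \<and> q mod m = p then t else 0)"
  have carr: "A \<in> carrier_mat N N" "U \<in> carrier_mat N N" "T \<in> carrier_mat N N"
    by (simp_all add: A_def U_def T_def)
  have mN: "m \<le> N" by (simp add: N_def)
  have "A * U = U * T"
  proof (rule eq_matI)
    fix p q assume "p < dim_row (U * T)" "q < dim_col (U * T)"
    then have p: "p < N" and q: "q < N" using carr by auto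
    have "(A * U) $$ (p, q) = (\<Sum>r = 0..<N. A $$ (p, r) * U $$ (r, q))"
      using p q carr by (simp add: scalar_prod_def)
    also have "\<dots> = (if q < m then if p mod m = q then d + of_nat k * t else 0 else A $$ (p, q))"
    proof (cases "q < m")
      case True
      have "(\<Sum>r = 0..<N. A $$ (p, r) * U $$ (r, q))
              = (\<Sum>r \<in> {r \<in> {0..<N}. r mod m = q}. A $$ (p, r))"
        unfolding sum.inter_filter[OF finite_atLeastLessThan]
        by (rule sum.cong) (use p q True in \<open>auto simp: U_def\<close>)
      \<comment> \<open>Splitting \<open>d\<close> as \<open>(d - t) + t\<close> leaves a constant
        over the \<open>k + 1\<close> members of the class and, if \<open>p\<close> is one of them,
        one extra term.\<close>
      also have "\<dots> = (\<Sum>r \<in> {r \<in> {0..<N}. r mod m = q}.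
                        (if r = p then d - t else 0) + (if p mod m = q then t else 0))"
        by (rule sum.cong) (use p in \<open>auto simp: A_def\<close>)
      also have "\<dots> = (if p mod m = q then d - t else 0)
                        + of_nat (k + 1) * (if p mod m = q then t else 0)"
        using p card_residue_class_lessThan[OF True, of "k + 1"]
        by (simp add: sum.distrib N_def)
      finally show ?thesis using True by (simp add: algebra_simps)
    next
      case False
      have "(\<Sum>r = 0..<N. A $$ (p, r) * U $$ (r, q))
              = (\<Sum>r = 0..<N. if r = q then A $$ (p, r) else 0)"
        by (rule sum.cong) (use q False in \<open>auto simp: U_def\<close>)
      then show ?thesis using q False by simp
    qed
    \<comment> \<open>Row \<open>p\<close> of \<open>U\<close> has its ones exactly at
      \<open>p\<close> and \<open>p mod m\<close>, which coincide when \<open>p < m\<close>.\<close>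
    also have "\<dots> = (if p < m then T $$ (p, q) else T $$ (p mod m, q) + T $$ (p, q))"
      using p q mN mod_less_divisor[OF m, of p] mod_less_divisor[OF m, of q] less_le_trans[OF mod_less_divisor[OF m, of p] mN]
      by (auto simp: A_def T_def)
    also have "\<dots> = (\<Sum>r = 0..<N. U $$ (p, r) * T $$ (r, q))"
    proof (cases "p < m")
      case True
      have "(\<Sum>r = 0..<N. U $$ (p, r) * T $$ (r, q))
              = (\<Sum>r = 0..<N. if r = p then T $$ (r, q) else 0)"
        by (rule sum.cong) (use p True in \<open>auto simp: U_def\<close>)
      then show ?thesis using p True by simp
    next
      case False
      have lt: "p mod m < m" using m by simp
      have "(\<Sum>r = 0..<N. U $$ (p, r) * T $$ (r, q))
              = (\<Sum>r = 0..<N. (if r = p mod m then T $$ (r, q) else 0)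
                               + (if r = p then T $$ (r, q) else 0))"
        by (rule sum.cong) (use p False lt in \<open>auto simp: U_def\<close>)
      then show ?thesis using p False lt mN by (simp add: sum.distrib)
    qed
    also have "\<dots> = (U * T) $$ (p, q)"
      using p q carr by (simp add: scalar_prod_def)
    finally show "(A * U) $$ (p, q) = (U * T) $$ (p, q)" .
  qed (use carr in auto)
  then have "det A * det U = det U * det T"
    using carr by (metis det_mult)
  moreover have "det U = 1"
  proof -
    have "det U = prod_list (diag_mat U)"
      by (rule det_lower_triangular[OF _ carr(2)])
        (auto simp: U_def)
    also have "\<dots> = 1" by (simp add: prod_list_diag_prod U_def)
    finally show ?thesis .
  qed
  moreover have "det T = (d + of_nat k * t) ^ m * (d - t) ^ (k * m)"
  proof -
    \<comment> \<open>Off the diagonal, column \<open>q\<close> can be nonzero only in row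
      \<open>q mod m\<close>, which is at most \<open>q\<close>.\<close>
    have "upper_triangular T"
      by (auto simp: upper_triangular_def T_def leD[OF mod_less_eq_dividend])
    then have "det T = (\<Prod>i = 0..<N. T $$ (i, i))"
      using det_upper_triangular[OF _ carr(3)] carr by (simp add: prod_list_diag_prod)
    also have "\<dots> = (\<Prod>i = 0..<m. T $$ (i, i)) * (\<Prod>i = m..<N. T $$ (i, i))"
      using mN by (simp add: prod.atLeastLessThan_concat)
    also have "(\<Prod>i = 0..<m. T $$ (i, i)) = (\<Prod>i = 0..<m. d + of_nat k * t)"
      by (rule prod.cong) (use mN in \<open>auto simp: T_def\<close>)
    also have "(\<Prod>i = m..<N. T $$ (i, i)) = (\<Prod>i = m..<N. d - t)"
      by (rule prod.cong) (auto simp: T_def)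
    finally show ?thesis by (simp add: N_def)
  qed
  ultimately show ?thesis by (simp add: A_def)
qed

text \<open>Column indices stay below \<open>n\<close>, so the subtracted entry is always
  \<open>c + 1 / n\<close>. It cancels off the diagonal and leaves \<open>- (n - 1) * c - c\<close>
  on it.\<close>

lemma Psi_eq_smult_one: "a \<noteq> b \<Longrightarrow> Psi n c a b = (- real n * c) \<cdot>\<^sub>m 1\<^sub>m (n - 1)"
  by (rule eq_matI) (auto simp: Psi_def s_def algebra_simps)

theorem mainTheorem3:
  fixes n :: nat and c :: real
  assumes "n \<ge> 2"
  shows "det (Gamma' n c) =
           (1 + real n * c) ^ (n^2 - n) * (1 - (real n)^2 * c) ^ (n - 1)"
proof -
  define m where "m = n - 1"
  have m: "m > 0" using assms by (simp add: m_def)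
  have n1: "n - Suc 0 = m" by (simp add: m_def)
  have N: "n^2 - 1 = (n + 1) * m" and e: "n^2 - n = n * m"
    by (simp_all add: m_def power2_eq_square algebra_simps)
  have "Gamma' n c = mat ((n + 1) * m) ((n + 1) * m)
          (\<lambda>(p, q). if p = q then 1 else if p mod m = q mod m then - real n * c else 0)"
    unfolding Gamma'_def N m_def[symmetric]
  proof (rule cong_mat)
    fix p q
    \<comment> \<open>Inside a diagonal block, equal remainders thus mean equal indices.\<close>
    have "p = q" if "p div m = q div m" "p mod m = q mod m"
      using that by (metis div_mult_mod_eq)
    then show "(case (p, q) of (p, q) \<Rightarrow> Gamma_block n c (p div m + 1) (q div m + 1)
                 $$ (p mod m, q mod m)) =
               (case (p, q) of (p, q) \<Rightarrow> if p = q then 1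
                 else if p mod m = q mod m then - real n * c else 0)"
      using m by (cases "p div m = q div m"; cases "p mod m = q mod m")
        (auto simp: Gamma_block_def Psi_eq_smult_one n1)
  qed simp_all
  \<comment> \<open>There are \<open>n + 1\<close> blocks in each row, hence
    \<open>k = n\<close>.\<close>
  then have "det (Gamma' n c)
      = (1 + real n * (- real n * c)) ^ m * (1 - (- real n * c)) ^ (n * m)"
    using det_two_valued_block_matrix[OF m, of n 1 "- real n * c"] by simp
  then show ?thesis
    unfolding e m_def[symmetric] by (simp add: power2_eq_square mult_ac)
qed

end
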